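(* Let $G$ be a $d$-degenerate graph. Then $G$ is weighted $\frac{1}{2^{d+1}}$-flexibly $(d+2)$-choosable.
   Context: A graph is $d$-degenerate if its vertices admit an ordering $v_1,\dots,v_n$ such that each $v_i$ has at most $d$ neighbours $v_j$ with $j>i$. A graph $G$ is weighted $\epsilon$-flexibly $k$-choosable if for every list-assignment $L$ with $|L(v)|=k$ for all $v\in V(G)$ there is a probability distribution on proper $L$-colourings $c$ of $G$ (i.e. $c(v)\in L(v)$ for all $v$ and $c(u)\neq c(v)$ for adjacent $u,v$) such that $\mathbb{P}(c(v)=x)\ge\epsilon$ for every vertex $v$ and every $x\in L(v)$. *)

theory Defs
  imports "HOL-Probability.Probability_Mass_Function" "Graph_Theory.Digraph"
begin

text \<open>
  Graphs are finite and simple: \<^locale>\<open>graph\<close> of Graph_Theory, i.e. a finite, loop-free,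
  symmetric digraph without parallel arcs.
\<close>

definition degenerate :: "('a, 'b) pre_digraph \<Rightarrow> nat \<Rightarrow> bool" where
  "degenerate G d \<longleftrightarrow>
     (\<exists>vs. distinct vs \<and> set vs = verts G \<and>
        (\<forall>i < length vs.
           card {j. i < j \<and> j < length vs \<and> (vs ! i) \<rightarrow>\<^bsub>G\<^esub> (vs ! j)} \<le> d))"

text \<open>
  Colourings are functions on the vertex set, represented by extensional functions
  (\<^term>\<open>undefined\<close> outside the vertices), so each colouring has a unique representative.
\<close>

definition proper_list_colourings ::
    "('a, 'b) pre_digraph \<Rightarrow> ('a \<Rightarrow> 'c set) \<Rightarrow> ('a \<Rightarrow> 'c) set" where
  "proper_list_colourings G L =
     {c \<in> (\<Pi>\<^sub>E v\<in>verts G. L v). \<forall>u v. u \<rightarrow>\<^bsub>G\<^esub> v \<longrightarrow> c u \<noteq> c v}"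

text \<open>
  The type argument is the universe of colours from which the lists are drawn. The set of proper
  list colourings is finite for a finite graph with finite lists, so discrete distributions are
  all the distributions on it. Finiteness of the lists is stated separately because
  \<^const>\<open>card\<close> is \<open>0\<close> on infinite sets.
\<close>

definition weighted_flexibly_choosable ::
    "'c itself \<Rightarrow> ('a, 'b) pre_digraph \<Rightarrow> real \<Rightarrow> nat \<Rightarrow> bool" where
  "weighted_flexibly_choosable _ G \<epsilon> k \<longleftrightarrow>
     (\<forall>L :: 'a \<Rightarrow> 'c set.
        (\<forall>v \<in> verts G. finite (L v) \<and> card (L v) = k) \<longrightarrow>
        (\<exists>p :: ('a \<Rightarrow> 'c) pmf.
           set_pmf p \<subseteq> proper_list_colourings G L \<and>
           (\<forall>v \<in> verts G. \<forall>x \<in> L v. measure_pmf.prob p {c. c v = x} \<ge> \<epsilon>)))"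

end

theory Submission
  imports Defs
begin

text \<open>
  Colour the vertices from last to first; each new vertex \<open>v\<close> draws a random pair of distinct
  available colours and a fair coin picks one of them. The random state remembers the discarded
  colour as well. For a fixed colour \<open>z\<close>, give a coloured vertex the factor \<open>0\<close> if it received \<open>z\<close>,
  \<open>2\<close> if it discarded \<open>z\<close>, and \<open>1\<close> otherwise; since the coin is fair, the product of these factors
  over any set of coloured vertices has mean \<open>1\<close>. Over the set \<open>S\<close> of coloured neighbours of \<open>v\<close>
  the product is \<open>2 ^ f z\<close> when \<open>z\<close> is available, where \<open>f z\<close> counts the members of \<open>S\<close> that
  discarded \<open>z\<close>, and \<open>0\<close> otherwise. So it suffices that an available \<open>z\<close> is chosen with conditional
  probability at least \<open>2 ^ f z / 2 ^ (d + 1)\<close>. These numbers are at most \<open>1 / 2\<close>, and since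
  \<open>f\<close> sums to at most \<open>d\<close> over at most \<open>d + 2\<close> colours, their sum is at most
  \<open>(2 ^ d - 1 + d + 2) / 2 ^ (d + 1) \<le> 1\<close>; hence a suitable distribution on pairs exists.
\<close>

section \<open>Sums of powers, bounded multisets and balanced pairings\<close>

text \<open>Repeated use of \<open>a + b \<le> a * b + 1\<close> for \<open>a, b \<ge> 1\<close>
  merges the powers: for a fixed total exponent the sum is largest when one element carries all of
  it.\<close>

lemma sum_power2_le:
  fixes f :: "'a \<Rightarrow> nat"
  assumes "finite A"
  shows "(\<Sum>z\<in>A. 2 ^ f z) + 1 \<le> card A + (2::nat) ^ (\<Sum>z\<in>A. f z)"
  using assms
proof (induction A)
  case (insert x A)
  have "a + b \<le> a * b + 1" if "a \<ge> 1" "b \<ge> 1" for a b :: nat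
    using that by (cases a; cases b) auto
  from this[of "2 ^ f x" "2 ^ sum f A"] insert show ?case
    by (simp add: power_add)
qed simp

text \<open>Elements are added one at a time. As \<open>A\<close> has at least two elements, all of
  them at multiplicity \<open>N\<close> would already give size at least \<open>2 * N\<close>, so
  below that size there is room.\<close>

lemma extend_mset_bounded:
  assumes "finite A" "card A \<ge> 2" "set_mset M \<subseteq> A" "\<And>z. count M z \<le> N" "size M \<le> 2 * N"
  obtains M' where "M \<subseteq># M'" "set_mset M' \<subseteq> A" "\<And>z. count M' z \<le> N" "size M' = 2 * N"
proof -
  have "\<exists>M'. M \<subseteq># M' \<and> set_mset M' \<subseteq> A \<and> (\<forall>z. count M' z \<le> N) \<and> size M' = 2 * N"
    using assms(3-5)
  proof (induction "2 * N - size M" arbitrary: M)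
    case 0
    then show ?case by auto
  next
    case (Suc n)
    have "\<exists>z\<in>A. count M z < N"
    proof (rule ccontr)
      assume "\<not> ?thesis"
      then have "count M z = N" if "z \<in> A" for z
        using Suc.prems(2)[of z] that by force
      then have "size M = card A * N"
        using sum.mono_neutral_left[of A "set_mset M" "count M"] Suc.prems(1) assms(1)
        by (simp add: size_multiset_overloaded_eq not_in_iff)
      then have "size M \<ge> 2 * N" using assms(2) by simp
      with Suc.hyps(2) show False by simp
    qed
    then obtain z where z: "z \<in> A" "count M z < N" by blast
    have "\<exists>M'. add_mset z M \<subseteq># M' \<and> set_mset M' \<subseteq> A \<and> (\<forall>z. count M' z \<le> N) \<and> size M' = 2 * N"
      using Suc.hyps(2) Suc.prems z by (intro Suc.hyps(1)) auto
    then show ?case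
      by (meson mset_subset_eq_insertD subset_mset.less_imp_le)
  qed
  then show thesis using that by blast
qed

text \<open>Equality at distance \<open>N\<close> in a sorted list would force a block of
  \<open>N + 1\<close> equal entries, more than the count permits.\<close>

lemma nth_neq_nth_add_sorted:
  fixes xs :: "'a :: linorder list"
  assumes "sorted xs" "i + N < length xs" "count_list xs (xs ! i) \<le> N"
  shows "xs ! i \<noteq> xs ! (i + N)"
proof
  assume eq: "xs ! i = xs ! (i + N)"
  have const: "xs ! j = xs ! i" if "j \<in> {i..i + N}" for j
    using that assms(1,2) eq sorted_nth_mono[of xs i j] sorted_nth_mono[of xs j "i + N"] by force
  have "{i..i + N} \<subseteq> {j. j < length xs \<and> xs ! j = xs ! i}"
    using assms(2) by (intro subsetI CollectI conjI const) auto
  then have "card {i..i + N} \<le> card {j. j < length xs \<and> xs ! j = xs ! i}"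
    by (intro card_mono) auto
  also have "\<dots> = count_list xs (xs ! i)"
    by (simp add: count_list_eq_length_filter length_filter_conv_card eq_commute)
  finally show False using assms(3) by simp
qed

lemma balanced_list_exists:
  assumes "size M = 2 * N" "\<And>z. count M z \<le> N"
  obtains xs where "mset xs = M" "\<And>i. i < N \<Longrightarrow> xs ! i \<noteq> xs ! (i + N)"
proof -
  \<comment> \<open>The element type carries no order, so an injection into \<open>nat\<close>
    supplies one for sorting.\<close>
  obtain f :: "'a \<Rightarrow> nat" where f: "inj_on f (set_mset M)"
    using finite_imp_inj_to_nat_seg[of "set_mset M"] by auto
  \<comment> \<open>In a sorted list equal entries are contiguous, so entries at distance \<open>N\<close> differ.\<close>
  define ys where "ys = sorted_list_of_multiset (image_mset f M)"
  define g where "g = the_inv_into (set_mset M) f"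
  have ys: "mset ys = image_mset f M" "sorted ys" "length ys = 2 * N"
    using assms(1) by (auto simp: ys_def simp flip: size_mset)
  have gf: "image_mset g (image_mset f M) = M"
    using f by (simp add: g_def multiset.map_comp the_inv_into_f_f cong: multiset.map_cong)
  have inj: "inj_on g (set ys)"
    using f ys(1) by (metis g_def inj_on_the_inv_into set_image_mset set_mset_mset)
  show thesis
  proof (rule that[of "map g ys"])
    show M: "mset (map g ys) = M" using ys(1) gf by simp
    fix i assume i: "i < N"
    have "count_list ys (ys ! i) \<le> count_list (map g ys) (g (ys ! i))"
      using count_list_map_ge by fastforce
    also have "\<dots> \<le> N"
      using assms(2) M by (metis count_mset)
    finally have "ys ! i \<noteq> ys ! (i + N)"
      using i ys by (intro nth_neq_nth_add_sorted) auto
    then show "map g ys ! i \<noteq> map g ys ! (i + N)"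
      using i ys(3) inj by (simp add: inj_on_eq_iff)
  qed
qed

section \<open>Random pairs with equal marginals and their mean colour factor\<close>

text \<open>Equal marginals are all that is kept of the fair coin between the two colours. The
  weights \<open>k z\<close> are padded to total exactly \<open>2 * N\<close>, and the cap
  \<open>N\<close> allows a split into pairs of distinct colours.\<close>

lemma pair_pmf_exists:
  fixes k :: "'c \<Rightarrow> nat"
  assumes "finite A" "card A \<ge> 2" "N > 0" "\<And>z. z \<in> A \<Longrightarrow> k z \<le> N" "(\<Sum>z\<in>A. k z) \<le> 2 * N"
  obtains K :: "('c \<times> 'c) pmf" where
    "\<And>a b. (a, b) \<in> set_pmf K \<Longrightarrow> a \<in> A \<and> b \<in> A \<and> a \<noteq> b"
    "map_pmf fst K = map_pmf snd K"
    "\<And>z. z \<in> A \<Longrightarrow> pmf (map_pmf fst K) z \<ge> real (k z) / (2 * real N)"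
proof -
  define M0 where "M0 = (\<Sum>z\<in>A. replicate_mset (k z) z)"
  have cM0: "count M0 z = (if z \<in> A then k z else 0)" for z
    using assms(1) by (simp add: M0_def count_sum)
  have "set_mset M0 \<subseteq> A"
    by (metis cM0 not_in_iff subsetI)
  moreover have "size M0 \<le> 2 * N"
    using assms(5) by (simp add: M0_def size_multiset_sum)
  ultimately obtain M where M: "M0 \<subseteq># M" "set_mset M \<subseteq> A" "\<And>z. count M z \<le> N" "size M = 2 * N"
    using extend_mset_bounded[of A M0 N] assms cM0 by (metis zero_le)
  obtain xs where xs: "mset xs = M" "\<And>i. i < N \<Longrightarrow> xs ! i \<noteq> xs ! (i + N)"
    using balanced_list_exists M by metis
  have len: "length xs = 2 * N" using xs(1) M(4) by (metis size_mset)
  \<comment> \<open>For a uniform index \<open>i\<close>, the pair of the entries at \<open>i\<close> and \<open>i + N\<close> modulo \<open>2 * N\<close> works.\<close>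
  define s where "s i = (if i < N then i + N else i - N)" for i
  define U where "U = pmf_of_set {..<2 * N}"
  define K where "K = map_pmf (\<lambda>i. (xs ! i, xs ! s i)) U"
  have setU: "set_pmf U = {..<2 * N}"
    unfolding U_def using assms(3) by (intro set_pmf_of_set) (auto simp: lessThan_empty_iff)
  have fst: "map_pmf fst K = map_pmf ((!) xs) U"
    by (simp add: K_def pmf.map_comp comp_def)
  \<comment> \<open>The shift is its own inverse, so it preserves the uniform index and both
    components get the same law.\<close>
  have "bij_betw s {..<2 * N} {..<2 * N}"
    by (rule bij_betwI[where g = s]) (auto simp: s_def)
  then have sU: "map_pmf s U = U"
    unfolding U_def using assms(3) by (intro map_pmf_of_set_bij_betw) (auto simp: lessThan_empty_iff)
  have "map_pmf snd K = map_pmf ((!) xs) (map_pmf s U)"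
    by (simp add: K_def pmf.map_comp comp_def)
  then have snd: "map_pmf snd K = map_pmf ((!) xs) U"
    unfolding sU .
  show thesis
  proof (rule that[of K])
    fix a b assume "(a, b) \<in> set_pmf K"
    then obtain i where i: "i < 2 * N" "a = xs ! i" "b = xs ! s i"
      by (auto simp: K_def setU)
    then have "s i < 2 * N" by (auto simp: s_def)
    then have "a \<in> A" "b \<in> A"
      using i len M(2) xs(1) by (metis nth_mem set_mset_mset subsetD)+
    moreover have "a \<noteq> b"
    proof (cases "i < N")
      case True
      then show ?thesis using i xs(2)[of i] by (simp add: s_def)
    next
      case False
      then have "i - N < N" "i - N + N = i" using i(1) by linarith+
      then have "xs ! (i - N) \<noteq> xs ! i" using xs(2)[of "i - N"] by metis
      then show ?thesis using i False by (simp add: s_def)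
    qed
    ultimately show "a \<in> A \<and> b \<in> A \<and> a \<noteq> b" by blast
  next
    show "map_pmf fst K = map_pmf snd K" by (simp add: fst snd)
  next
    fix z assume z: "z \<in> A"
    have "k z \<le> count_list xs z"
      using M(1) z xs(1) by (metis cM0 count_mset mset_subset_eq_count)
    also have "count_list xs z = card ({..<2 * N} \<inter> (!) xs -` {z})"
      by (auto simp: count_list_eq_length_filter length_filter_conv_card len eq_commute
          intro!: arg_cong[of _ _ card])
    finally show "pmf (map_pmf fst K) z \<ge> real (k z) / (2 * real N)"
      using assms(3) unfolding fst pmf_map U_def
      by (subst measure_pmf_of_set) (auto simp: lessThan_empty_iff intro!: divide_right_mono)
  qed
qed

text \<open>The first component of a pair is the received colour, the second the discarded one.\<close>

definition colour_factor :: "'c \<Rightarrow> 'c \<times> 'c \<Rightarrow> ennreal" where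
  "colour_factor z = (\<lambda>(a, b). if a = z then 0 else if b = z then 2 else 1)"

text \<open>For \<open>a \<noteq> b\<close> the factor plus the indicator of \<open>a = z\<close>
  equals 1 plus the indicator of \<open>b = z\<close>; under equal marginals the two indicators have
  the same mean.\<close>

lemma nn_integral_colour_factor:
  assumes "\<And>a b. (a, b) \<in> set_pmf K \<Longrightarrow> a \<noteq> b" "map_pmf fst K = map_pmf snd K"
  shows "(\<integral>\<^sup>+x. colour_factor z x \<partial>measure_pmf K) = 1"
proof -
  have "(\<integral>\<^sup>+x. colour_factor z x \<partial>K) + (\<integral>\<^sup>+x. indicator {z} (fst x) \<partial>K)
      = (\<integral>\<^sup>+x. colour_factor z x + indicator {z} (fst x) \<partial>K)"
    by (simp add: nn_integral_add)
  also have "\<dots> = (\<integral>\<^sup>+x. 1 + indicator {z} (snd x) \<partial>K)"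
    using assms(1) by (intro nn_integral_cong_AE)
      (fastforce simp: AE_measure_pmf_iff colour_factor_def indicator_def)
  also have "\<dots> = 1 + (\<integral>\<^sup>+x. indicator {z} x \<partial>map_pmf snd K)"
    by (simp add: nn_integral_add measure_pmf.emeasure_space_1)
  also have "map_pmf snd K = map_pmf fst K" using assms(2) by simp
  also have "(\<integral>\<^sup>+x. indicator {z} x \<partial>map_pmf fst K) = (\<integral>\<^sup>+x. indicator {z} (fst x) \<partial>K)"
    by simp
  also have "\<dots> = emeasure K {x. fst x = z}"
    by (subst nn_integral_indicator[symmetric]) (auto intro!: nn_integral_cong simp del: nn_integral_indicator simp: indicator_def)
  \<comment> \<open>Cancelling the common summand in \<open>ennreal\<close> needs it to be
    finite.\<close>
  finally show ?thesis
    using measure_pmf.emeasure_finite[of K "{x. fst x = z}"]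
    by (metis add.commute ennreal_add_left_cancel infinity_ennreal_def)
qed

section \<open>The random choice at one vertex\<close>

lemma colour_pair_pmf_exists:
  fixes w :: "'a \<Rightarrow> 'c \<times> 'c"
  assumes S: "finite S" "card S \<le> d" and C: "finite C" "card C = d + 2"
  obtains K :: "('c \<times> 'c) pmf" where
    "\<And>a b. (a, b) \<in> set_pmf K \<Longrightarrow> a \<in> C - (fst \<circ> w) ` S \<and> a \<noteq> b"
    "map_pmf fst K = map_pmf snd K"
    "\<And>z. z \<in> C \<Longrightarrow>
      (\<Prod>u\<in>S. colour_factor z (w u)) * ennreal (1 / 2 ^ (d + 1)) \<le> ennreal (pmf (map_pmf fst K) z)"
proof -
  define A where "A = C - (fst \<circ> w) ` S"
  define f where "f z = card {u \<in> S. snd (w u) = z}" for z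
  have finA: "finite A" using C by (simp add: A_def)
  have cardA: "card A \<ge> 2"
    using diff_card_le_card_Diff[of "(fst \<circ> w) ` S" C] card_image_le[OF S(1), of "fst \<circ> w"] S C
    by (simp add: A_def)
  have f_le: "f z \<le> d" for z
    using S card_mono[of S "{u \<in> S. snd (w u) = z}"] by (auto simp: f_def)
  \<comment> \<open>Each vertex of \<open>S\<close> discards a single colour, so the counted sets
    are disjoint.\<close>
  have "(\<Sum>z\<in>A. f z) = card (\<Union>z\<in>A. {u \<in> S. snd (w u) = z})"
    unfolding f_def using finA S by (intro card_UN_disjoint[symmetric]) auto
  also have "\<dots> \<le> card S"
    using S by (intro card_mono) auto
  finally have "(\<Sum>z\<in>A. f z) \<le> d" using S by simp
  then have "(2::nat) ^ (\<Sum>z\<in>A. f z) \<le> 2 ^ d"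
    by (intro power_increasing) auto
  moreover have "card A \<le> d + 2"
    using C card_mono[of C A] by (simp add: A_def)
  \<comment> \<open>The total weight is at most \<open>2 ^ d + d + 1\<close>, hence at most
    \<open>2 * 2 ^ d\<close>.\<close>
  moreover have "d < 2 ^ d" by (rule less_exp)
  ultimately have sum: "(\<Sum>z\<in>A. 2 ^ f z) \<le> (2::nat) * 2 ^ d"
    using sum_power2_le[OF finA, of f] by linarith
  obtain K where K: "\<And>a b. (a, b) \<in> set_pmf K \<Longrightarrow> a \<in> A \<and> b \<in> A \<and> a \<noteq> b"
    "map_pmf fst K = map_pmf snd K"
    "\<And>z. z \<in> A \<Longrightarrow> pmf (map_pmf fst K) z \<ge> 2 ^ f z / (2 * 2 ^ d)"
    using f_le by (rule_tac pair_pmf_exists[OF finA cardA _ _ sum]) (auto simp: power_increasing)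
  show thesis
  proof (rule that[of K])
    fix z assume z: "z \<in> C"
    show "(\<Prod>u\<in>S. colour_factor z (w u)) * ennreal (1 / 2 ^ (d + 1)) \<le> ennreal (pmf (map_pmf fst K) z)"
    proof (cases "z \<in> A")
      case True
      then have "fst (w u) \<noteq> z" if "u \<in> S" for u
        using that by (auto simp: A_def)
      then have "colour_factor z (w u) = (if snd (w u) = z then 2 else 1)" if "u \<in> S" for u
        using that by (simp add: colour_factor_def case_prod_beta)
      then have "(\<Prod>u\<in>S. colour_factor z (w u)) = (\<Prod>u\<in>S. if snd (w u) = z then 2 else 1)"
        by simp
      also have "\<dots> = 2 ^ f z"
        using S by (simp add: f_def flip: prod.inter_filter)
      also have "\<dots> = ennreal (2 ^ f z)"
        by (simp flip: ennreal_power ennreal_numeral)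
      finally have "(\<Prod>u\<in>S. colour_factor z (w u)) * ennreal (1 / 2 ^ (d + 1))
          = ennreal (2 ^ f z / 2 ^ (d + 1))"
        by (simp flip: ennreal_mult)
      then show ?thesis using K(3)[OF True] by (simp add: ennreal_leI)
    next
      case False
      \<comment> \<open>Some vertex of \<open>S\<close> has received \<open>z\<close>, and its
        factor 0 makes the bound trivial.\<close>
      then obtain u where "u \<in> S" "colour_factor z (w u) = 0"
        using z by (auto simp: A_def colour_factor_def case_prod_beta)
      then have "(\<Prod>u\<in>S. colour_factor z (w u)) = 0"
        using S by (intro prod_zero) auto
      then show ?thesis by (simp only: mult_zero_left zero_le)
    qed
  qed (use K A_def in auto)
qed

section \<open>Colouring along the degeneracy order\<close>

text \<open>The head is coloured after the tail. The mean-one condition is the invariant that turns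
  conditional bounds at the head into the final one; it ranges over all subsets since any of them
  may be the neighbourhood of a later head.\<close>

lemma degenerate_order_pmf_exists:
  fixes R :: "'a \<Rightarrow> 'a \<Rightarrow> bool" and L :: "'a \<Rightarrow> 'c set"
  assumes "symp R" "irreflp R" "distinct vs"
    and "\<And>i. i < length vs \<Longrightarrow> card {j. i < j \<and> j < length vs \<and> R (vs ! i) (vs ! j)} \<le> d"
    and "\<And>v. v \<in> set vs \<Longrightarrow> finite (L v) \<and> card (L v) = d + 2"
  shows "\<exists>p :: ('a \<Rightarrow> 'c \<times> 'c) pmf.
    (\<forall>w\<in>set_pmf p. \<forall>u\<in>set vs. fst (w u) \<in> L u \<and> (\<forall>v\<in>set vs. R u v \<longrightarrow> fst (w u) \<noteq> fst (w v))) \<and>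
    (\<forall>S z. S \<subseteq> set vs \<longrightarrow> (\<integral>\<^sup>+w. (\<Prod>u\<in>S. colour_factor z (w u)) \<partial>measure_pmf p) = 1) \<and>
    (\<forall>v\<in>set vs. \<forall>z\<in>L v. ennreal (1 / 2 ^ (d + 1)) \<le> emeasure (measure_pmf p) {w. fst (w v) = z})"
    (is "\<exists>p. ?P vs p")
  using assms(3-5)
proof (induction vs)
  case Nil
  show ?case
    by (rule exI[of _ "return_pmf undefined"]) (simp add: measure_pmf.emeasure_space_1)
next
  case (Cons v vs)
  have "card {j. i < j \<and> j < length vs \<and> R (vs ! i) (vs ! j)} \<le> d" if "i < length vs" for i
  proof -
    have "card {j. i < j \<and> j < length vs \<and> R (vs ! i) (vs ! j)}
        = card (Suc ` {j. i < j \<and> j < length vs \<and> R (vs ! i) (vs ! j)})"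
      by (simp add: card_image)
    also have "\<dots> \<le> card {j. Suc i < j \<and> j < length (v # vs) \<and> R ((v # vs) ! Suc i) ((v # vs) ! j)}"
      by (intro card_mono) auto
    also have "\<dots> \<le> d" using that by (intro Cons.prems(2)) auto
    finally show ?thesis .
  qed
  then have "\<exists>p. ?P vs p"
    using Cons.prems(1,3) by (intro Cons.IH) auto
  then obtain p where p: "?P vs p" ..
  have p1: "fst (w u) \<in> L u" if "w \<in> set_pmf p" "u \<in> set vs" for w u
    using p that by blast
  have p2: "fst (w u) \<noteq> fst (w u')" if "w \<in> set_pmf p" "u \<in> set vs" "u' \<in> set vs" "R u u'" for w u u'
    using p that by blast
  have p3: "(\<integral>\<^sup>+w. (\<Prod>u\<in>S. colour_factor z (w u)) \<partial>measure_pmf p) = 1" if "S \<subseteq> set vs" for S z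
    using p that by blast
  have p4: "ennreal (1 / 2 ^ (d + 1)) \<le> emeasure (measure_pmf p) {w. fst (w u) = z}"
    if "u \<in> set vs" "z \<in> L u" for u z
    using p that by blast
  define S where "S = {u \<in> set vs. R v u}"
  have S: "finite S" "S \<subseteq> set vs" by (auto simp: S_def)
  let ?J = "{j. 0 < j \<and> j < length (v # vs) \<and> R ((v # vs) ! 0) ((v # vs) ! j)}"
  have "S \<subseteq> (!) (v # vs) ` ?J"
  proof
    fix u assume "u \<in> S"
    then obtain j where "j < length vs" "u = vs ! j" "R v u"
      by (auto simp: S_def in_set_conv_nth)
    then show "u \<in> (!) (v # vs) ` ?J"
      by (intro image_eqI[of _ _ "Suc j"]) auto
  qed
  then have "card S \<le> card ?J" by (intro surj_card_le) auto
  also have "\<dots> \<le> d" using Cons.prems(2)[of 0] by simp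
  finally have cardS: "card S \<le> d" .
  \<comment> \<open>This holds for every \<open>w\<close>, also outside the support of
    \<open>p\<close>, so choice gives a total function for \<open>bind_pmf\<close>.\<close>
  have "\<exists>K. (\<forall>a b. (a, b) \<in> set_pmf K \<longrightarrow> a \<in> L v - (fst \<circ> w) ` S \<and> a \<noteq> b) \<and>
      map_pmf fst K = map_pmf snd K \<and>
      (\<forall>z\<in>L v. (\<Prod>u\<in>S. colour_factor z (w u)) * ennreal (1 / 2 ^ (d + 1))
         \<le> ennreal (pmf (map_pmf fst K) z))" for w :: "'a \<Rightarrow> 'c \<times> 'c"
    using colour_pair_pmf_exists[OF S(1) cardS, of "L v" w] Cons.prems(3)[of v]
    by (metis list.set_intros(1))
  then obtain K where
    K1: "\<And>w a b. (a, b) \<in> set_pmf (K w) \<Longrightarrow> a \<in> L v - (fst \<circ> w) ` S \<and> a \<noteq> b" and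
    K2: "\<And>w. map_pmf fst (K w) = map_pmf snd (K w)" and
    K3: "\<And>w z. z \<in> L v \<Longrightarrow> (\<Prod>u\<in>S. colour_factor z (w u)) * ennreal (1 / 2 ^ (d + 1))
         \<le> ennreal (pmf (map_pmf fst (K w)) z)"
    by metis
  define q where "q = bind_pmf p (\<lambda>w. map_pmf (\<lambda>x. w(v := x)) (K w))"
  show ?case
  proof (intro exI[of _ q] conjI ballI allI impI)
    fix w' u assume w': "w' \<in> set_pmf q" and u: "u \<in> set (v # vs)"
    from w' obtain w a b where w: "w \<in> set_pmf p" "(a, b) \<in> set_pmf (K w)" "w' = w(v := (a, b))"
      by (auto simp: q_def)
    note a = K1[OF w(2)]
    show "fst (w' u) \<in> L u" using u w a p1 by auto
    fix u' assume u': "u' \<in> set (v # vs)" "R u u'"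
    moreover have "R u' u" using u' assms(1) by (auto dest: sympD)
    moreover have "u \<noteq> u'" using u' assms(2) by (auto dest: irreflpD)
    ultimately show "fst (w' u) \<noteq> fst (w' u')"
      using u w a p2[OF w(1), of u u'] by (auto simp: S_def)
  next
    fix T and z :: 'c assume T: "T \<subseteq> set (v # vs)"
    then have finT: "finite T" using finite_subset by blast
    \<comment> \<open>Only the factor at \<open>v\<close> depends on the new pair, and its
      conditional mean is 1 whatever \<open>w\<close> is.\<close>
    have "(\<Prod>u\<in>T. colour_factor z ((w(v := x)) u))
        = (\<Prod>u\<in>T - {v}. colour_factor z (w u)) * (if v \<in> T then colour_factor z x else 1)" for w x
      using finT by (cases "v \<in> T") (auto simp: prod.remove[of T v] mult.commute intro!: prod.cong)
    moreover have "(\<integral>\<^sup>+x. (if v \<in> T then colour_factor z x else 1) \<partial>K w) = 1" for w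
      using nn_integral_colour_factor[OF _ K2] K1
      by (cases "v \<in> T") (auto simp: measure_pmf.emeasure_space_1)
    ultimately have "(\<integral>\<^sup>+w. (\<Prod>u\<in>T. colour_factor z (w u)) \<partial>q)
        = (\<integral>\<^sup>+w. (\<Prod>u\<in>T - {v}. colour_factor z (w u)) \<partial>p)"
      by (simp add: q_def nn_integral_cmult)
    also have "\<dots> = 1" using T by (intro p3) auto
    finally show "(\<integral>\<^sup>+w. (\<Prod>u\<in>T. colour_factor z (w u)) \<partial>q) = 1" .
  next
    fix u z assume u: "u \<in> set (v # vs)" and z: "z \<in> L u"
    have q: "emeasure q {w. fst (w u) = z} = (\<integral>\<^sup>+w. emeasure (K w) {x. fst ((w(v := x)) u) = z} \<partial>p)"
      by (simp add: q_def vimage_def)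
    show "ennreal (1 / 2 ^ (d + 1)) \<le> emeasure q {w. fst (w u) = z}"
    proof (cases "u = v")
      case True
      \<comment> \<open>As the product over \<open>S\<close> has mean 1, the conditional lower
        bounds average to the constant.\<close>
      have "ennreal (1 / 2 ^ (d + 1))
          = (\<integral>\<^sup>+w. (\<Prod>u\<in>S. colour_factor z (w u)) * ennreal (1 / 2 ^ (d + 1)) \<partial>p)"
        using p3[OF S(2), of z] by (simp add: nn_integral_multc)
      also have "\<dots> \<le> (\<integral>\<^sup>+w. ennreal (pmf (map_pmf fst (K w)) z) \<partial>p)"
        using K3 z True by (intro nn_integral_mono) auto
      also have "\<dots> = emeasure q {w. fst (w u) = z}"
        unfolding q unfolding True
        by (intro nn_integral_cong) (auto simp: pmf_map measure_pmf.emeasure_eq_measure vimage_def)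
      finally show ?thesis .
    next
      case False
      have "emeasure q {w. fst (w u) = z} = (\<integral>\<^sup>+w. indicator {w. fst (w u) = z} w \<partial>p)"
        unfolding q using False
        by (intro nn_integral_cong) (auto simp: indicator_def measure_pmf.emeasure_space_1[simplified])
      also have "\<dots> = emeasure p {w. fst (w u) = z}" by simp
      finally show ?thesis using p4[of u z] u z False by simp
    qed
  qed
qed

theorem theorem2p7:
  fixes G :: "('a, 'b) pre_digraph" and d :: nat
  assumes "Digraph.graph G"
    and "degenerate G d"
  shows "weighted_flexibly_choosable TYPE('c) G (1 / 2 ^ (d + 1)) (d + 2)"
  unfolding weighted_flexibly_choosable_def
proof (intro allI impI)
  fix L :: "'a \<Rightarrow> 'c set"
  assume L: "\<forall>v\<in>verts G. finite (L v) \<and> card (L v) = d + 2"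
  interpret Digraph.graph G by fact
  define R where "R u v \<longleftrightarrow> u \<rightarrow>\<^bsub>G\<^esub> v" for u v
  have "symp R" by (auto simp: R_def intro!: sympI arcs_ends_symmetric[OF sym_arcs])
  moreover have "irreflp R" by (auto simp: R_def irreflp_def dest: adj_not_same)
  moreover obtain vs where vs: "distinct vs" "set vs = verts G"
    "\<And>i. i < length vs \<Longrightarrow> card {j. i < j \<and> j < length vs \<and> R (vs ! i) (vs ! j)} \<le> d"
    using assms(2) by (auto simp: degenerate_def R_def)
  ultimately obtain p :: "('a \<Rightarrow> 'c \<times> 'c) pmf" where
    p: "\<forall>w\<in>set_pmf p. \<forall>u\<in>verts G.
        fst (w u) \<in> L u \<and> (\<forall>v\<in>verts G. R u v \<longrightarrow> fst (w u) \<noteq> fst (w v))"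
      "\<forall>v\<in>verts G. \<forall>z\<in>L v. ennreal (1 / 2 ^ (d + 1)) \<le> emeasure (measure_pmf p) {w. fst (w v) = z}"
    using degenerate_order_pmf_exists[of R vs d L] L by auto
  \<comment> \<open>The discarded colours are forgotten; restricting makes the colouring
    extensional, as \<open>proper_list_colourings\<close> demands.\<close>
  define r where "r w = restrict (fst \<circ> w) (verts G)" for w :: "'a \<Rightarrow> 'c \<times> 'c"
  show "\<exists>p :: ('a \<Rightarrow> 'c) pmf. set_pmf p \<subseteq> proper_list_colourings G L \<and>
      (\<forall>v\<in>verts G. \<forall>x\<in>L v. measure_pmf.prob p {c. c v = x} \<ge> 1 / 2 ^ (d + 1))"
  proof (intro exI[of _ "map_pmf r p"] conjI ballI)
    show "set_pmf (map_pmf r p) \<subseteq> proper_list_colourings G L"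
      using p(1) by (auto simp: proper_list_colourings_def r_def R_def adj_in_verts)
    fix v x assume "v \<in> verts G" "x \<in> L v"
    moreover from this have "r -` {c. c v = x} = {w. fst (w v) = x}"
      by (auto simp: r_def)
    ultimately show "measure_pmf.prob (map_pmf r p) {c. c v = x} \<ge> 1 / 2 ^ (d + 1)"
      using p(2) by (simp add: measure_pmf.emeasure_eq_measure)
  qed
qed

end
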